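(* Let $\psi>0$, $\mathbf{v}\in\mathbb{R}^d$, and let $\mathbf{z}^*$ denote the optimal solution of $$\min_{\mathbf{z}\in\mathbb{R}^d}\ \frac12\|\mathbf{z}-\mathbf{v}\|^2\quad\text{s.t.}\quad\|\mathbf{z}\|_1\le\psi .$$ If $\|\mathbf{v}\|_1\le\psi$, then $\mathbf{z}^*=\mathbf{v}$. Otherwise, let $i_1,\dots,i_d$ be a permutation of $\{1,\dots,d\}$ such that $|\mathbf{v}_{i_1}|\ge|\mathbf{v}_{i_2}|\ge\dots\ge|\mathbf{v}_{i_d}|$, and let $s_0=0$, $s_d=\|\mathbf{v}\|_1$ and $$s_m=\sum_{t=1}^m|\mathbf{v}_{i_t}|-m|\mathbf{v}_{i_{m+1}}|,\qquad m=1,\dots,d-1 .$$ Then $s_m$ is a non-decreasing sequence. Moreover, if $s_{\bar m-1}<\psi\le s_{\bar m}$ for some $\bar m\in\{1,\dots,d\}$, then $$\mathbf{z}^*_{i_t}=\begin{cases}0&\text{if }\bar m<t\le d,\\[2pt]\mathbf{v}_{i_t}-\dfrac{\mathrm{sgn}(\mathbf{v}_{i_t})}{\bar m}\left(\displaystyle\sum_{k=1}^{\bar m}|\mathbf{v}_{i_k}|-\psi\right)&\text{if }1\le t\le\bar m.\end{cases}$$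
   Context: $\|\cdot\|$ is the Euclidean norm, $\|\cdot\|_1$ the $\ell_1$-norm, $\mathbf{v}_i$ the $i$-th component of $\mathbf{v}$, and $\mathrm{sgn}$ the sign function. *)

theory Defs
  imports "HOL-Analysis.Analysis"
begin

definition l1_norm :: "real ^ 'n \<Rightarrow> real" where
  "l1_norm v = (\<Sum>j\<in>UNIV. \<bar>v $ j\<bar>)"

definition l1_proj_optimal :: "real \<Rightarrow> real ^ 'n \<Rightarrow> real ^ 'n \<Rightarrow> bool" where
  "l1_proj_optimal \<psi> v z \<longleftrightarrow>
     is_arg_min (\<lambda>z. 1 / 2 * (norm (z - v))\<^sup>2) (\<lambda>z. l1_norm z \<le> \<psi>) z"

text \<open>The coordinates of \<open>real ^ 'n\<close> carry no order, so a permutation \<open>i\<^sub>1, \<dots>, i\<^sub>d\<close> of the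
  coordinates is a bijection from \<open>{1..d}\<close> to \<open>'n\<close>, where \<open>d = CARD('n)\<close>.\<close>

definition abs_decreasing_enum :: "real ^ 'n \<Rightarrow> (nat \<Rightarrow> 'n) \<Rightarrow> bool" where
  "abs_decreasing_enum v i \<longleftrightarrow>
     bij_betw i {1..CARD('n)} UNIV \<and>
     (\<forall>t\<in>{1..<CARD('n)}. \<bar>v $ i t\<bar> \<ge> \<bar>v $ i (t + 1)\<bar>)"

text \<open>Only the values at \<open>m \<le> CARD('n)\<close> are meaningful.\<close>

definition thresh_seq :: "real ^ 'n \<Rightarrow> (nat \<Rightarrow> 'n) \<Rightarrow> nat \<Rightarrow> real" where
  "thresh_seq v i m =
     (if m = 0 then 0
      else if m = CARD('n) then l1_norm v
      else (\<Sum>t=1..m. \<bar>v $ i t\<bar>) - real m * \<bar>v $ i (m + 1)\<bar>)"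

end

theory Submission
  imports Defs
begin

text \<open>
  The feasible set is a nonempty closed convex set, so the optimal solution is the unique
  nearest point of the \<open>\<ell>\<^sub>1\<close>-ball to \<open>v\<close>; it therefore suffices to exhibit one optimal point.

  The candidate is the soft thresholding of \<open>v\<close>, which moves every coordinate towards \<open>0\<close> by
  \<open>\<tau>\<close>, stopping at \<open>0\<close>. If \<open>\<tau>\<close> is chosen such that the result \<open>z\<close> lies on the sphere \<open>\<parallel>z\<parallel>\<^sub>1 = \<psi>\<close>, then \<open>v - z\<close>
  has all coordinates in \<open>[-\<tau>, \<tau>]\<close>, and equals \<open>\<tau>\<close> times the sign of \<open>z\<close> on the support of
  \<open>z\<close>. Hence \<open>(v - z) \<bullet> w \<le> \<tau> \<parallel>w\<parallel>\<^sub>1 \<le> \<tau> \<psi> = (v - z) \<bullet> z\<close> for every feasible \<open>w\<close>, which is the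
  variational inequality that characterises the nearest point
  (\<open>soft_threshold_optimal\<close>).

  To find \<open>\<tau>\<close>, sort the absolute values as \<open>a\<^sub>1 \<ge> \<dots> \<ge> a\<^sub>d\<close> and put \<open>a\<^sub>t = 0\<close> for \<open>t > d\<close>. With
  this padding \<open>s\<^sub>m = a\<^sub>1 + \<dots> + a\<^sub>m - m a\<^sub>m\<^sub>+\<^sub>1\<close> holds for all \<open>m \<le> d\<close>, including both end points
  (\<open>thresh_seq_padded\<close>), and \<open>s\<^sub>m\<close> is the \<open>\<ell>\<^sub>1\<close>-norm left after thresholding at level
  \<open>a\<^sub>m\<^sub>+\<^sub>1\<close>. Its increments are \<open>(m + 1) (a\<^sub>m\<^sub>+\<^sub>1 - a\<^sub>m\<^sub>+\<^sub>2) \<ge> 0\<close>. For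
  \<open>\<tau> = (a\<^sub>1 + \<dots> + a\<^sub>m - \<psi>) / m\<close> the condition \<open>s\<^sub>m\<^sub>-\<^sub>1 < \<psi> \<le> s\<^sub>m\<close> says exactly
  \<open>a\<^sub>m\<^sub>+\<^sub>1 \<le> \<tau> < a\<^sub>m\<close>, so that thresholding at \<open>\<tau>\<close> keeps the first \<open>m\<close> sorted coordinates, kills
  the others, and leaves \<open>\<ell>\<^sub>1\<close>-norm \<open>\<psi>\<close>.
\<close>

section \<open>Projection onto the \<open>\<ell>\<^sub>1\<close>-ball\<close>

lemma l1_proj_optimal_iff_nearest:
  "l1_proj_optimal \<psi> v z \<longleftrightarrow>
     z \<in> {z. l1_norm z \<le> \<psi>} \<and> (\<forall>w\<in>{z. l1_norm z \<le> \<psi>}. dist v z \<le> dist v w)"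
proof -
  have "1 / 2 * (norm (w - v))\<^sup>2 < 1 / 2 * (norm (z - v))\<^sup>2 \<longleftrightarrow> dist v w < dist v z" for w
    by (simp add: dist_norm norm_minus_commute power_mono_iff flip: not_le)
  then show ?thesis
    unfolding l1_proj_optimal_def is_arg_min_def by (auto simp: not_less)
qed

lemma convex_l1_ball: "convex {z. l1_norm z \<le> \<psi>}"
proof (rule convexI)
  fix x y :: "real ^ 'n" and u w :: real
  assume feasible: "x \<in> {z. l1_norm z \<le> \<psi>}" "y \<in> {z. l1_norm z \<le> \<psi>}"
    and weights: "0 \<le> u" "0 \<le> w" "u + w = 1"
  have "\<bar>(u *\<^sub>R x + w *\<^sub>R y) $ j\<bar> \<le> u * \<bar>x $ j\<bar> + w * \<bar>y $ j\<bar>" for j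
    using abs_triangle_ineq[of "u * x $ j" "w * y $ j"] weights by (simp add: abs_mult)
  then have "l1_norm (u *\<^sub>R x + w *\<^sub>R y) \<le> u * l1_norm x + w * l1_norm y"
    unfolding l1_norm_def sum_distrib_left sum.distrib[symmetric] by (rule sum_mono)
  also have "\<dots> \<le> \<psi>"
    using feasible weights by (intro convex_bound_le) auto
  finally show "u *\<^sub>R x + w *\<^sub>R y \<in> {z. l1_norm z \<le> \<psi>}" by simp
qed

lemma closed_l1_ball: "closed {z. l1_norm z \<le> \<psi>}"
  unfolding l1_norm_def by (intro closed_Collect_le continuous_intros)

lemma l1_proj_optimal_unique:
  assumes "l1_proj_optimal \<psi> v x" "l1_proj_optimal \<psi> v y"
  shows "x = y"
  using any_closest_point_unique[OF convex_l1_ball closed_l1_ball] assms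
  unfolding l1_proj_optimal_iff_nearest by blast

lemma l1_proj_optimal_exists:
  fixes v :: "real ^ 'n"
  assumes "\<psi> \<ge> 0"
  shows "\<exists>z. l1_proj_optimal \<psi> v z"
proof -
  have "(0 :: real ^ 'n) \<in> {z. l1_norm z \<le> \<psi>}"
    using assms by (simp add: l1_norm_def)
  then have "{z :: real ^ 'n. l1_norm z \<le> \<psi>} \<noteq> {}" by blast
  from closest_point_exists[OF closed_l1_ball this] show ?thesis
    unfolding l1_proj_optimal_iff_nearest by blast
qed

lemma l1_proj_optimal_self:
  assumes "l1_norm v \<le> \<psi>"
  shows "l1_proj_optimal \<psi> v v"
  using assms by (simp add: l1_proj_optimal_iff_nearest)

text \<open>The sufficient half of the obtuse-angle criterion for nearest points: the cross term in
  \<open>\<parallel>v - w\<parallel>\<^sup>2 = \<parallel>v - z\<parallel>\<^sup>2 + 2 (v - z) \<bullet> (z - w) + \<parallel>z - w\<parallel>\<^sup>2\<close> is nonnegative.\<close>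

lemma nearest_if_inner_le:
  fixes v w z :: "'a::real_inner"
  assumes "(v - z) \<bullet> w \<le> (v - z) \<bullet> z"
  shows "dist v z \<le> dist v w"
proof -
  have "(v - w) \<bullet> (v - w) = (v - z) \<bullet> (v - z) + 2 * ((v - z) \<bullet> (z - w)) + (z - w) \<bullet> (z - w)"
    by (simp add: inner_diff_left inner_diff_right inner_commute)
  moreover have "(v - z) \<bullet> (z - w) \<ge> 0"
    using assms by (simp add: inner_diff_right)
  ultimately have "(v - z) \<bullet> (v - z) \<le> (v - w) \<bullet> (v - w)"
    using inner_ge_zero[of "z - w"] by linarith
  then show ?thesis
    unfolding dist_norm norm_le .
qed

section \<open>Soft thresholding\<close>

definition soft_threshold :: "real \<Rightarrow> real ^ 'n \<Rightarrow> real ^ 'n" where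
  "soft_threshold \<tau> v = (\<chi> j. sgn (v $ j) * max 0 (\<bar>v $ j\<bar> - \<tau>))"

lemma abs_soft_threshold:
  assumes "\<tau> \<ge> 0"
  shows "\<bar>soft_threshold \<tau> v $ j\<bar> = max 0 (\<bar>v $ j\<bar> - \<tau>)"
  using assms by (auto simp: soft_threshold_def sgn_if)

text \<open>The residual \<open>v - z\<close> is \<open>\<tau>\<close> times a subgradient of the \<open>\<ell>\<^sub>1\<close>-norm at \<open>z\<close>; the two facts
  below are the coordinatewise form of this optimality condition.\<close>

lemma soft_threshold_residual_le:
  assumes "\<tau> \<ge> 0"
  shows "\<bar>v $ j - soft_threshold \<tau> v $ j\<bar> \<le> \<tau>"
  using assms by (auto simp: soft_threshold_def sgn_if max_def)

lemma soft_threshold_residual_inner: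
  assumes "\<tau> \<ge> 0"
  shows "(v $ j - soft_threshold \<tau> v $ j) * soft_threshold \<tau> v $ j
           = \<tau> * \<bar>soft_threshold \<tau> v $ j\<bar>"
  using assms by (auto simp: soft_threshold_def sgn_if max_def algebra_simps)

lemma soft_threshold_optimal:
  fixes v :: "real ^ 'n"
  assumes \<tau>: "\<tau> \<ge> 0" and norm: "l1_norm (soft_threshold \<tau> v) = \<psi>"
  shows "l1_proj_optimal \<psi> v (soft_threshold \<tau> v)"
proof -
  let ?z = "soft_threshold \<tau> v"
  have "(v - ?z) \<bullet> w \<le> (v - ?z) \<bullet> ?z" if w: "l1_norm w \<le> \<psi>" for w
  proof -
    have "(v $ j - ?z $ j) * w $ j \<le> \<tau> * \<bar>w $ j\<bar>" for j
    proof -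
      have "(v $ j - ?z $ j) * w $ j \<le> \<bar>v $ j - ?z $ j\<bar> * \<bar>w $ j\<bar>"
        by (metis abs_ge_self abs_mult)
      also have "\<dots> \<le> \<tau> * \<bar>w $ j\<bar>"
        by (intro mult_right_mono soft_threshold_residual_le \<tau>) simp
      finally show ?thesis .
    qed
    then have "(v - ?z) \<bullet> w \<le> \<tau> * l1_norm w"
      by (simp add: inner_vec_def l1_norm_def sum_distrib_left sum_mono)
    also have "\<dots> \<le> \<tau> * l1_norm ?z"
      using w \<tau> norm by (simp add: mult_left_mono)
    also have "\<dots> = (v - ?z) \<bullet> ?z"
      by (simp add: inner_vec_def l1_norm_def sum_distrib_left soft_threshold_residual_inner \<tau>)
    finally show ?thesis .
  qed
  then show ?thesis
    using norm by (simp add: l1_proj_optimal_iff_nearest nearest_if_inner_le)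
qed

section \<open>Sorted coordinates and the sequence of thresholds\<close>

text \<open>Continuing the sorted absolute values by \<open>0\<close> keeps them decreasing and makes the final
  case \<open>m = d\<close> of the sequence \<open>s\<^sub>m\<close> an instance of the general formula.\<close>

definition padded_abs :: "real ^ 'n \<Rightarrow> (nat \<Rightarrow> 'n) \<Rightarrow> nat \<Rightarrow> real" where
  "padded_abs v i t = (if t \<le> CARD('n) then \<bar>v $ i t\<bar> else 0)"

lemma padded_abs_nonneg: "padded_abs v i t \<ge> 0"
  by (simp add: padded_abs_def)

lemma padded_abs_antimono:
  assumes "abs_decreasing_enum v i" "1 \<le> s" "s \<le> t"
  shows "padded_abs v i t \<le> padded_abs v i s"
  using assms(3)
proof (induction t rule: dec_induct)
  case (step t)
  have "padded_abs v i (Suc t) \<le> padded_abs v i t"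
    using assms(1,2) step.hyps by (auto simp: abs_decreasing_enum_def padded_abs_def)
  with step.IH show ?case by simp
qed simp

lemma sum_enum:
  fixes f :: "'n::finite \<Rightarrow> real"
  assumes "abs_decreasing_enum (v :: real ^ 'n) i"
  shows "(\<Sum>j\<in>UNIV. f j) = (\<Sum>t=1..CARD('n). f (i t))"
  using assms sum.reindex_bij_betw[of i "{1..CARD('n)}" UNIV f]
  by (simp add: abs_decreasing_enum_def)

lemma sum_padded_abs:
  assumes "m \<le> CARD('n)"
  shows "(\<Sum>t=1..m. padded_abs (v :: real ^ 'n) i t) = (\<Sum>t=1..m. \<bar>v $ i t\<bar>)"
  using assms by (intro sum.cong) (auto simp: padded_abs_def)

lemma thresh_seq_padded:
  fixes v :: "real ^ 'n"
  assumes "abs_decreasing_enum v i" "m \<le> CARD('n)"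
  shows "thresh_seq v i m = (\<Sum>t=1..m. padded_abs v i t) - real m * padded_abs v i (m + 1)"
  using assms(2) unfolding sum_padded_abs[OF assms(2)]
  by (auto simp: thresh_seq_def padded_abs_def l1_norm_def sum_enum[OF assms(1)])

lemma thresh_seq_mono:
  fixes v :: "real ^ 'n"
  assumes "abs_decreasing_enum v i"
  shows "mono_on {0..CARD('n)} (thresh_seq v i)"
proof -
  let ?s = "\<lambda>m. (\<Sum>t=1..m. padded_abs v i t) - real m * padded_abs v i (m + 1)"
  have "incseq ?s"
  proof (rule incseq_SucI)
    fix m
    \<comment> \<open>the increment is \<open>(m + 1) (a\<^sub>m\<^sub>+\<^sub>1 - a\<^sub>m\<^sub>+\<^sub>2)\<close>\<close>
    have "0 \<le> real (m + 1) * (padded_abs v i (m + 1) - padded_abs v i (m + 2))"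
      using padded_abs_antimono[OF assms, of "m + 1" "m + 2"] by (intro mult_nonneg_nonneg) auto
    then show "?s m \<le> ?s (Suc m)"
      by (simp add: algebra_simps)
  qed
  then show ?thesis
    by (auto simp: mono_on_def thresh_seq_padded[OF assms] dest: incseqD)
qed

text \<open>A level \<open>\<tau>\<close> separating the first \<open>m\<close> sorted absolute values from the rest shortens each
  of those \<open>m\<close> coordinates by the full \<open>\<tau>\<close> and sends all others to \<open>0\<close>.\<close>

lemma l1_norm_soft_threshold:
  fixes v :: "real ^ 'n"
  assumes enum: "abs_decreasing_enum v i" and m: "1 \<le> m" "m \<le> CARD('n)"
    and low: "padded_abs v i (m + 1) \<le> \<tau>" and high: "\<tau> \<le> padded_abs v i m"
  shows "l1_norm (soft_threshold \<tau> v) = (\<Sum>t=1..m. padded_abs v i t) - real m * \<tau>"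
proof -
  have \<tau>: "\<tau> \<ge> 0"
    using low padded_abs_nonneg[of v i "m + 1"] by linarith
  have alive: "max 0 (\<bar>v $ i t\<bar> - \<tau>) = padded_abs v i t - \<tau>" if "t \<in> {1..m}" for t
    using padded_abs_antimono[OF enum, of t m] that m high by (auto simp: padded_abs_def)
  have dead: "max 0 (\<bar>v $ i t\<bar> - \<tau>) = 0" if "t \<in> {1..CARD('n)} - {1..m}" for t
    using padded_abs_antimono[OF enum, of "m + 1" t] that low by (auto simp: padded_abs_def)
  have "l1_norm (soft_threshold \<tau> v) = (\<Sum>t=1..CARD('n). max 0 (\<bar>v $ i t\<bar> - \<tau>))"
    unfolding l1_norm_def abs_soft_threshold[OF \<tau>] by (rule sum_enum[OF enum])
  also have "\<dots> = (\<Sum>t=1..m. max 0 (\<bar>v $ i t\<bar> - \<tau>))"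
    by (intro sum.mono_neutral_right) (use m dead in auto)
  also have "\<dots> = (\<Sum>t=1..m. padded_abs v i t) - real m * \<tau>"
    by (simp add: alive sum_subtractf)
  finally show ?thesis .
qed

text \<open>Solving \<open>a\<^sub>1 + \<dots> + a\<^sub>m - m \<tau> = \<psi>\<close> for \<open>\<tau>\<close> turns the bracketing of \<open>\<psi>\<close> by consecutive
  values of the sequence into the bracketing of \<open>\<tau>\<close> by consecutive sorted absolute values.\<close>

lemma threshold_bounds:
  fixes v :: "real ^ 'n"
  assumes enum: "abs_decreasing_enum v i" and m: "1 \<le> m" "m \<le> CARD('n)"
    and \<tau>: "\<tau> = ((\<Sum>t=1..m. padded_abs v i t) - \<psi>) / real m"
  shows "\<psi> \<le> thresh_seq v i m \<longleftrightarrow> padded_abs v i (m + 1) \<le> \<tau>"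
    and "thresh_seq v i (m - 1) < \<psi> \<longleftrightarrow> \<tau> < padded_abs v i m"
proof -
  show "\<psi> \<le> thresh_seq v i m \<longleftrightarrow> padded_abs v i (m + 1) \<le> \<tau>"
    using m unfolding thresh_seq_padded[OF enum m(2)] \<tau> by (auto simp: field_simps)
  obtain k where k: "m = Suc k"
    using m by (cases m) auto
  \<comment> \<open>adding and subtracting \<open>a\<^sub>m\<close> expresses the previous value of the sequence by the sum up to \<open>m\<close>\<close>
  have "thresh_seq v i (m - 1) = (\<Sum>t=1..m. padded_abs v i t) - real m * padded_abs v i m"
    using m by (simp add: thresh_seq_padded[OF enum] k algebra_simps)
  then show "thresh_seq v i (m - 1) < \<psi> \<longleftrightarrow> \<tau> < padded_abs v i m"
    using m unfolding \<tau> by (auto simp: field_simps)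
qed

lemma l1_proj_optimal_sorted:
  fixes v :: "real ^ 'n"
  assumes enum: "abs_decreasing_enum v i" and m: "1 \<le> m" "m \<le> CARD('n)"
    and lower: "thresh_seq v i (m - 1) < \<psi>" and upper: "\<psi> \<le> thresh_seq v i m"
    and opt: "l1_proj_optimal \<psi> v z" and t: "1 \<le> t" "t \<le> CARD('n)"
  shows "z $ i t = (if m < t then 0
    else v $ i t - sgn (v $ i t) / real m * ((\<Sum>k=1..m. \<bar>v $ i k\<bar>) - \<psi>))"
proof -
  define \<tau> where "\<tau> = ((\<Sum>t=1..m. padded_abs v i t) - \<psi>) / real m"
  have low: "padded_abs v i (m + 1) \<le> \<tau>" and high: "\<tau> < padded_abs v i m"
    using threshold_bounds[OF enum m \<tau>_def] lower upper by auto
  have "l1_norm (soft_threshold \<tau> v) = \<psi>"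
    using l1_norm_soft_threshold[OF enum m low] high m by (simp add: \<tau>_def)
  moreover have "\<tau> \<ge> 0"
    using low padded_abs_nonneg[of v i "m + 1"] by linarith
  ultimately have z: "z = soft_threshold \<tau> v"
    using soft_threshold_optimal l1_proj_optimal_unique[OF opt] by blast
  show ?thesis
  proof (cases "m < t")
    case True
    then have "\<bar>v $ i t\<bar> \<le> \<tau>"
      using padded_abs_antimono[OF enum, of "m + 1" t] low t by (auto simp: padded_abs_def)
    with True show ?thesis
      by (simp add: z soft_threshold_def)
  next
    case False
    then have "\<tau> < \<bar>v $ i t\<bar>"
      using padded_abs_antimono[OF enum, of t m] high t by (auto simp: padded_abs_def)
    then have "z $ i t = v $ i t - sgn (v $ i t) * \<tau>"
      by (simp add: z soft_threshold_def sgn_mult_abs right_diff_distrib)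
    with False show ?thesis
      unfolding \<tau>_def sum_padded_abs[OF m(2)] by simp
  qed
qed

section \<open>The optimal solution\<close>

theorem lemma4:
  fixes \<psi> :: real and v :: "real ^ 'n"
  assumes "\<psi> > 0"
  shows "(\<exists>!z. l1_proj_optimal \<psi> v z) \<and>
    (\<forall>zs. l1_proj_optimal \<psi> v zs \<longrightarrow>
      (l1_norm v \<le> \<psi> \<longrightarrow> zs = v) \<and>
      (\<not> l1_norm v \<le> \<psi> \<longrightarrow>
        (\<forall>i. abs_decreasing_enum v i \<longrightarrow>
          mono_on {0..CARD('n)} (thresh_seq v i) \<and>
          (\<forall>mb\<in>{1..CARD('n)}.
            thresh_seq v i (mb - 1) < \<psi> \<and> \<psi> \<le> thresh_seq v i mb \<longrightarrow>
            (\<forall>t\<in>{1..CARD('n)}.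
              zs $ i t =
                (if mb < t then 0
                 else v $ i t - sgn (v $ i t) / real mb *
                        ((\<Sum>k=1..mb. \<bar>v $ i k\<bar>) - \<psi>)))))))"
proof (intro conjI allI impI ballI)
  show "\<exists>!z. l1_proj_optimal \<psi> v z"
    using l1_proj_optimal_exists[of \<psi> v] l1_proj_optimal_unique assms by fastforce
next
  fix zs assume "l1_proj_optimal \<psi> v zs" "l1_norm v \<le> \<psi>"
  then show "zs = v"
    using l1_proj_optimal_self l1_proj_optimal_unique by blast
next
  fix i assume "abs_decreasing_enum v i"
  then show "mono_on {0..CARD('n)} (thresh_seq v i)"
    by (rule thresh_seq_mono)
next
  fix zs i mb t
  assume "l1_proj_optimal \<psi> v zs" "abs_decreasing_enum v i"
    "mb \<in> {1..CARD('n)}" "t \<in> {1..CARD('n)}"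
    "thresh_seq v i (mb - 1) < \<psi> \<and> \<psi> \<le> thresh_seq v i mb"
  then show "zs $ i t = (if mb < t then 0
      else v $ i t - sgn (v $ i t) / real mb * ((\<Sum>k=1..mb. \<bar>v $ i k\<bar>) - \<psi>))"
    by (intro l1_proj_optimal_sorted) auto
qed

end
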